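(* Let $\mathrm{H}:\mathbf{Top}_0\to\mathbf{Set}$ be an R-subset system and let $\{X_i : i\in I\}$ be a family of $T_0$ spaces. Then the following two conditions are equivalent: (1) The product space $\prod_{i\in I}X_i$ is $\mathrm{H}$-sober. (2) For each $i\in I$, $X_i$ is $\mathrm{H}$-sober.
   Context: $\mathbf{Top}_0$ is the category of all $T_0$ spaces with continuous mappings, and $\mathbf{Set}$ is the category of all sets with mappings. A subset $A$ of a space $X$ is irreducible if it is nonempty and whenever $A\subseteq F_1\cup F_2$ with $F_1,F_2$ closed in $X$, then $A\subseteq F_1$ or $A\subseteq F_2$. An R-subset system (irreducible subset system) is a covariant functor $\mathrm{H}:\mathbf{Top}_0\to\mathbf{Set}$ such that (i) for every $T_0$ space $X$, $\mathrm{H}(X)$ is a set of irreducible subsets of $X$ which contains all singletons $\{x\}$, $x\in X$; (ii) for every continuous mapping $f:X\to Y$ between $T_0$ spaces and every $A\in \mathrm{H}(X)$, $\mathrm{H}(f)(A)=f(A)\in \mathrm{H}(Y)$. A $T_0$ space $X$ is $\mathrm{H}$-sober if for every $A\in\mathrm{H}(X)$ there is a (necessarily unique) point $x\in X$ with $\overline{A}=\overline{\{x\}}$.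
   Formalization: The spaces X_i are assumed nonempty (with an empty factor the product is empty and (1) does not imply (2)); all spaces are taken inside one arbitrary universe on which H is given, with the product taken up to homeomorphism. *)

theory Defs
  imports "HOL-Analysis.Analysis"
begin

definition irreducible_in :: "'a topology \<Rightarrow> 'a set \<Rightarrow> bool" where
  "irreducible_in X A \<longleftrightarrow> A \<subseteq> topspace X \<and> A \<noteq> {} \<and>
     (\<forall>F1 F2. closedin X F1 \<longrightarrow> closedin X F2 \<longrightarrow> A \<subseteq> F1 \<union> F2 \<longrightarrow> A \<subseteq> F1 \<or> A \<subseteq> F2)"

text \<open>
  The category of T0 spaces is rendered by all T0 topologies whose carrier is an arbitrary subset
  of the type \<open>'u\<close>, which acts as the universe and is itself arbitrary. A functor into sets that
  sends a continuous map to the direct image operator is determined by its action on objects: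
  identities and composition are preserved by direct images, so only well-definedness of
  \<open>A \<mapsto> f ` A\<close> has to be required.
\<close>

definition R_subset_system :: "('u topology \<Rightarrow> 'u set set) \<Rightarrow> bool" where
  "R_subset_system H \<longleftrightarrow>
     (\<forall>X. t0_space X \<longrightarrow>
        (\<forall>A\<in>H X. irreducible_in X A) \<and> (\<forall>x\<in>topspace X. {x} \<in> H X)) \<and>
     (\<forall>X Y f. t0_space X \<longrightarrow> t0_space Y \<longrightarrow> continuous_map X Y f \<longrightarrow>
        (\<forall>A\<in>H X. f ` A \<in> H Y))"

definition H_sober :: "('u topology \<Rightarrow> 'u set set) \<Rightarrow> 'u topology \<Rightarrow> bool" where
  "H_sober H X \<longleftrightarrow> t0_space X \<and>
     (\<forall>A\<in>H X. \<exists>x\<in>topspace X. X closure_of A = X closure_of {x})"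

text \<open>
  The functor acts on topologies over \<open>'u\<close>, while \<^const>\<open>product_topology\<close> has carrier type
  \<open>'i \<Rightarrow> 'u\<close>. A product of a family in the category is therefore a space over \<open>'u\<close> that is
  homeomorphic to the product topology. Every family of T0 spaces and its product have copies over
  a sufficiently large \<open>'u\<close>, for example \<open>'i \<Rightarrow> 'a\<close> for nonempty index sets and factors over \<open>'a\<close>.
\<close>

definition is_product_space :: "'u topology \<Rightarrow> ('i \<Rightarrow> 'u topology) \<Rightarrow> 'i set \<Rightarrow> bool" where
  "is_product_space P X I \<longleftrightarrow> P homeomorphic_space product_topology X I"

end

theory Submission
  imports Defs
begin

text \<open>
  Two points of view on the equation \<open>cl A = cl {x}\<close> drive the proof: it is preserved by continuous
  maps, and it says that an open set meets \<open>A\<close> exactly when it contains \<open>x\<close>.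
  Call such an \<open>x\<close> a generic point of \<open>A\<close>. The space \<open>P\<close> is identified with the product along a
  homeomorphism.

  From the product to a factor: since all factors are nonempty, each \<open>X i\<close> is a retract of the
  product, embedded as a slice through a chosen base point. \<open>H\<close>-sobriety passes to retracts
  (\<open>H_sober_retract\<close>): push \<open>A \<in> H (X i)\<close> into the product, take a generic point there, and
  project it back.

  From the factors to the product: let \<open>A \<in> H P\<close>. By functoriality each projection of \<open>A\<close> is in
  \<open>H (X i)\<close>, hence has a generic point \<open>x i\<close>. The point \<open>x\<close> lies in an open box iff every side
  of the box meets the corresponding projection of \<open>A\<close>. As only finitely many sides are proper and
  \<open>A\<close> is irreducible, these finitely many separate meetings can be merged into one, so the box
  contains \<open>x\<close> iff it meets \<open>A\<close> (\<open>box_meets_irreducible_iff\<close>). Boxes form a base, so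
  \<open>x\<close> is a generic point of \<open>A\<close>.
\<close>

lemma closure_of_eq_closure_of_sing_iff:
  assumes "A \<subseteq> topspace X" "x \<in> topspace X"
  shows "X closure_of A = X closure_of {x} \<longleftrightarrow> (\<forall>U. openin X U \<longrightarrow> (x \<in> U \<longleftrightarrow> U \<inter> A \<noteq> {}))"
    (is "?L \<longleftrightarrow> ?R")
proof
  assume L: ?L
  show ?R
  proof (intro allI impI)
    fix U assume U: "openin X U"
    have "U \<inter> A = {} \<longleftrightarrow> U \<inter> X closure_of A = {}" "U \<inter> {x} = {} \<longleftrightarrow> U \<inter> X closure_of {x} = {}"
      using openin_Int_closure_of_eq_empty[OF U] by auto
    with L show "x \<in> U \<longleftrightarrow> U \<inter> A \<noteq> {}" by auto
  qed
next
  assume ?R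
  then show ?L by (auto simp: closure_of_def)
qed

lemma continuous_map_closure_of_eq_image:
  assumes f: "continuous_map X Y f" and "A \<subseteq> topspace X" "x \<in> topspace X"
    and eq: "X closure_of A = X closure_of {x}"
  shows "Y closure_of (f ` A) = Y closure_of {f x}"
proof -
  have fx: "f x \<in> topspace Y" and fA: "f ` A \<subseteq> topspace Y"
    using continuous_map_funspace[OF f] assms(2,3) by auto
  have "f x \<in> V \<longleftrightarrow> V \<inter> f ` A \<noteq> {}" if "openin Y V" for V
  proof -
    have "openin X {z \<in> topspace X. f z \<in> V}"
      using openin_continuous_map_preimage[OF f that] .
    then have "x \<in> {z \<in> topspace X. f z \<in> V} \<longleftrightarrow> {z \<in> topspace X. f z \<in> V} \<inter> A \<noteq> {}"
      using eq closure_of_eq_closure_of_sing_iff[OF assms(2,3)] by blast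
    with assms(2,3) show ?thesis by auto
  qed
  then show ?thesis
    using closure_of_eq_closure_of_sing_iff[OF fA fx] by blast
qed

lemma R_subset_systemD:
  assumes "R_subset_system H"
  shows "\<And>X A. t0_space X \<Longrightarrow> A \<in> H X \<Longrightarrow> irreducible_in X A"
    and "\<And>X Y f A. t0_space X \<Longrightarrow> t0_space Y \<Longrightarrow> continuous_map X Y f \<Longrightarrow> A \<in> H X \<Longrightarrow> f ` A \<in> H Y"
  using assms unfolding R_subset_system_def by blast+

lemma irreducible_in_subset_topspace: "irreducible_in X A \<Longrightarrow> A \<subseteq> topspace X"
  by (simp add: irreducible_in_def)

text \<open>
  A generic point of the image of \<open>A\<close> in the ambient space is sent by the retraction to a generic
  point of \<open>A\<close>, because continuous maps preserve equality of closures.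
\<close>

lemma H_sober_retract:
  assumes H: "R_subset_system H" and Y: "H_sober H Y" and X: "t0_space X"
    and ret: "retraction_maps Y X r s"
  shows "H_sober H X"
  unfolding H_sober_def
proof (intro conjI ballI X)
  fix A assume A: "A \<in> H X"
  have r: "continuous_map Y X r" and s: "continuous_map X Y s"
    and rs: "\<And>x. x \<in> topspace X \<Longrightarrow> r (s x) = x"
    using ret by (auto simp: retraction_maps_def)
  have t0Y: "t0_space Y" using Y by (simp add: H_sober_def)
  have AX: "A \<subseteq> topspace X"
    using R_subset_systemD(1)[OF H X A] by (rule irreducible_in_subset_topspace)
  have sA: "s ` A \<in> H Y" using R_subset_systemD(2)[OF H X t0Y s A] .
  then obtain y where y: "y \<in> topspace Y" "Y closure_of (s ` A) = Y closure_of {y}"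
    using Y unfolding H_sober_def by blast
  have sAY: "s ` A \<subseteq> topspace Y"
    using R_subset_systemD(1)[OF H t0Y sA] by (rule irreducible_in_subset_topspace)
  have "r ` s ` A = A" using AX rs by force
  then have "X closure_of A = X closure_of {r y}"
    using continuous_map_closure_of_eq_image[OF r sAY y] by simp
  moreover have "r y \<in> topspace X" using continuous_map_funspace[OF r] y(1) by auto
  ultimately show "\<exists>x\<in>topspace X. X closure_of A = X closure_of {x}" by blast
qed

lemma irreducible_in_continuous_map_image:
  assumes f: "continuous_map X Y f" and A: "irreducible_in X A"
  shows "irreducible_in Y (f ` A)"
  unfolding irreducible_in_def
proof (intro conjI allI impI)
  have AX: "A \<subseteq> topspace X" using A by (rule irreducible_in_subset_topspace)
  then show "f ` A \<subseteq> topspace Y" using continuous_map_funspace[OF f] by auto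
  show "f ` A \<noteq> {}" using A by (simp add: irreducible_in_def)
  fix F G assume FG: "closedin Y F" "closedin Y G" "f ` A \<subseteq> F \<union> G"
  let ?pre = "\<lambda>F. {x \<in> topspace X. f x \<in> F}"
  have "closedin X (?pre F)" "closedin X (?pre G)"
    using FG closedin_continuous_map_preimage[OF f] by auto
  moreover have "A \<subseteq> ?pre F \<union> ?pre G" using FG(3) AX by auto
  ultimately have "A \<subseteq> ?pre F \<or> A \<subseteq> ?pre G"
    using A unfolding irreducible_in_def by blast
  then show "f ` A \<subseteq> F \<or> f ` A \<subseteq> G" by auto
qed

text \<open>
  The dual of the definition by closed sets: pass to complements for two open sets, then induct.
\<close>

lemma irreducible_in_meets_Inter:
  assumes A: "irreducible_in X A" and "finite J"
    and "\<And>j. j \<in> J \<Longrightarrow> openin X (U j)" "\<And>j. j \<in> J \<Longrightarrow> U j \<inter> A \<noteq> {}"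
  shows "(\<Inter>j\<in>J. U j) \<inter> A \<noteq> {}"
proof -
  have AX: "A \<subseteq> topspace X" using A by (rule irreducible_in_subset_topspace)
  have two: "V \<inter> W \<inter> A \<noteq> {}"
    if "openin X V" "openin X W" "V \<inter> A \<noteq> {}" "W \<inter> A \<noteq> {}" for V W
  proof
    assume "V \<inter> W \<inter> A = {}"
    then have "A \<subseteq> (topspace X - V) \<union> (topspace X - W)" using AX by blast
    moreover have "closedin X (topspace X - V)" "closedin X (topspace X - W)"
      using that by auto
    ultimately have "A \<subseteq> topspace X - V \<or> A \<subseteq> topspace X - W"
      using A unfolding irreducible_in_def by blast
    with that(3,4) show False by blast
  qed
  \<comment> \<open>Intersecting with the whole space keeps the set open when the family is empty.\<close>
  have "openin X (topspace X \<inter> (\<Inter>j\<in>J. U j)) \<and> topspace X \<inter> (\<Inter>j\<in>J. U j) \<inter> A \<noteq> {}"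
    using assms(2-)
  proof (induction J)
    case empty
    then show ?case using A AX by (auto simp: irreducible_in_def)
  next
    case (insert j J)
    let ?V = "topspace X \<inter> (\<Inter>j\<in>J. U j)"
    have V: "openin X ?V" "?V \<inter> A \<noteq> {}" and Uj: "openin X (U j)" "U j \<inter> A \<noteq> {}"
      using insert by auto
    have "topspace X \<inter> (\<Inter>j\<in>insert j J. U j) = U j \<inter> ?V" by auto
    then show ?case using two[OF Uj(1) V(1) Uj(2) V(2)] openin_Int[OF Uj(1) V(1)] by simp
  qed
  then show ?thesis by auto
qed

text \<open>
  Membership in a box is a conjunction of conditions on open cylinders; all but finitely many of
  them hold on the whole space, and irreducibility merges the remaining ones.
\<close>

lemma box_meets_irreducible_iff:
  assumes B: "irreducible_in (product_topology X I) B"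
    and U: "\<And>i. i \<in> I \<Longrightarrow> openin (X i) (U i)"
    and fin: "finite {i \<in> I. U i \<noteq> topspace (X i)}"
  shows "PiE I U \<inter> B \<noteq> {} \<longleftrightarrow> (\<forall>i\<in>I. U i \<inter> (\<lambda>b. b i) ` B \<noteq> {})"
proof
  assume "PiE I U \<inter> B \<noteq> {}"
  then show "\<forall>i\<in>I. U i \<inter> (\<lambda>b. b i) ` B \<noteq> {}" by (auto dest: PiE_mem)
next
  assume meets: "\<forall>i\<in>I. U i \<inter> (\<lambda>b. b i) ` B \<noteq> {}"
  let ?P = "product_topology X I"
  let ?J = "{i \<in> I. U i \<noteq> topspace (X i)}"
  define C where "C i = {b \<in> topspace ?P. b i \<in> U i}" for i
  have BP: "B \<subseteq> topspace ?P" using B by (rule irreducible_in_subset_topspace)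
  have "(\<Inter>i\<in>?J. C i) \<inter> B \<noteq> {}"
  proof (rule irreducible_in_meets_Inter[OF B fin])
    fix i assume i: "i \<in> ?J"
    then have "i \<in> I" by simp
    then have "continuous_map ?P (X i) (\<lambda>b. b i)" "openin (X i) (U i)"
      by (simp_all add: continuous_map_product_projection U)
    then show "openin ?P (C i)"
      unfolding C_def by (rule openin_continuous_map_preimage)
    show "C i \<inter> B \<noteq> {}" using i meets BP unfolding C_def by blast
  qed
  then obtain b where b: "b \<in> B" "\<And>i. i \<in> ?J \<Longrightarrow> b i \<in> U i" by (auto simp: C_def)
  have "b \<in> topspace ?P" using b(1) BP by blast
  then have "b i \<in> topspace (X i)" if "i \<in> I" for i
    using that by (auto simp: PiE_iff)
  then have "b i \<in> U i" if "i \<in> I" for i using b(2)[of i] that by (cases "i \<in> ?J") auto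
  with \<open>b \<in> topspace ?P\<close> have "b \<in> PiE I U" by (simp add: PiE_iff)
  with b(1) show "PiE I U \<inter> B \<noteq> {}" by blast
qed

text \<open>
  Comparing which open sets contain \<open>x\<close> with which ones meet \<open>B\<close> only has to be done on a base.
\<close>

lemma generic_point_in_product:
  assumes B: "irreducible_in (product_topology X I) B"
    and x: "x \<in> topspace (product_topology X I)"
    and gen: "\<And>i. i \<in> I \<Longrightarrow> X i closure_of ((\<lambda>b. b i) ` B) = X i closure_of {x i}"
  shows "product_topology X I closure_of B = product_topology X I closure_of {x}"
proof -
  let ?P = "product_topology X I"
  have BP: "B \<subseteq> topspace ?P" using B by (rule irreducible_in_subset_topspace)
  have side: "x i \<in> V \<longleftrightarrow> V \<inter> (\<lambda>b. b i) ` B \<noteq> {}" if i: "i \<in> I" and V: "openin (X i) V" for i V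
  proof -
    have "(\<lambda>b. b i) ` B \<subseteq> topspace (X i)" "x i \<in> topspace (X i)"
      using BP x i by (auto simp: PiE_iff)
    from closure_of_eq_closure_of_sing_iff[OF this] gen[OF i] V show ?thesis by blast
  qed
  have box: "x \<in> PiE I U \<longleftrightarrow> PiE I U \<inter> B \<noteq> {}"
    if "\<forall>i\<in>I. openin (X i) (U i)" "finite {i \<in> I. U i \<noteq> topspace (X i)}" for U
    using box_meets_irreducible_iff[OF B _ that(2)] that(1) side x by (simp add: PiE_iff)
  have "x \<in> W \<longleftrightarrow> W \<inter> B \<noteq> {}" if "openin ?P W" for W
  proof -
    have base: "\<exists>U. finite {i \<in> I. U i \<noteq> topspace (X i)} \<and> (\<forall>i\<in>I. openin (X i) (U i)) \<and>
        w \<in> PiE I U \<and> PiE I U \<subseteq> W" if "w \<in> W" for w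
      using \<open>openin ?P W\<close> that unfolding openin_product_topology_alt by blast
    show ?thesis
    proof
      assume "x \<in> W"
      then obtain U where "finite {i \<in> I. U i \<noteq> topspace (X i)}" "\<forall>i\<in>I. openin (X i) (U i)"
        "x \<in> PiE I U" "PiE I U \<subseteq> W" using base by blast
      with box[of U] show "W \<inter> B \<noteq> {}" by blast
    next
      assume "W \<inter> B \<noteq> {}"
      then obtain b where "b \<in> B" "b \<in> W" by blast
      then obtain U where "finite {i \<in> I. U i \<noteq> topspace (X i)}" "\<forall>i\<in>I. openin (X i) (U i)"
        "b \<in> PiE I U" "PiE I U \<subseteq> W" using base by blast
      with box[of U] \<open>b \<in> B\<close> show "x \<in> W" by blast
    qed
  qed
  then show ?thesis using closure_of_eq_closure_of_sing_iff[OF BP x] by blast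
qed

theorem theorem4p29:
  fixes H :: "'u topology \<Rightarrow> 'u set set"
    and X :: "'i \<Rightarrow> 'u topology" and I :: "'i set" and P :: "'u topology"
  assumes "R_subset_system H"
    and "\<And>i. i \<in> I \<Longrightarrow> t0_space (X i)"
    and "\<And>i. i \<in> I \<Longrightarrow> topspace (X i) \<noteq> {}"
    and "is_product_space P X I"
  shows "H_sober H P \<longleftrightarrow> (\<forall>i\<in>I. H_sober H (X i))"
proof -
  let ?Q = "product_topology X I"
  note H = assms(1)
  obtain h g where hg: "homeomorphic_maps P ?Q h g"
    using assms(4) by (auto simp: is_product_space_def homeomorphic_space_def)
  have h: "continuous_map P ?Q h" and g: "continuous_map ?Q P g"
    and gh: "\<And>p. p \<in> topspace P \<Longrightarrow> g (h p) = p"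
    using hg by (auto simp: homeomorphic_maps_def)
  have t0P: "t0_space P"
    using assms(2,4) by (auto simp: is_product_space_def t0_space_product_topology
        dest: homeomorphic_t0_space)
  show ?thesis
  proof
    assume P: "H_sober H P"
    show "\<forall>i\<in>I. H_sober H (X i)"
    proof
      fix i assume i: "i \<in> I"
      have "?Q \<noteq> trivial_topology"
        using assms(3) by (auto simp: product_topology_trivial_iff)
      \<comment> \<open>A section of the projection embeds \<open>X i\<close> as a slice through a base point.\<close>
      then obtain s where "retraction_maps ?Q (X i) (\<lambda>x. x i) s"
        using retraction_map_product_projection[OF i, of X] i assms(3)
        by (auto simp: retraction_map_def)
      moreover have "retraction_maps P ?Q h g"
        using hg by (auto simp: homeomorphic_maps_def retraction_maps_def)
      ultimately have "retraction_maps P (X i) ((\<lambda>x. x i) \<circ> h) (g \<circ> s)"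
        by (rule retraction_maps_compose[rotated])
      then show "H_sober H (X i)" by (rule H_sober_retract[OF H P assms(2)[OF i]])
    qed
  next
    assume fac: "\<forall>i\<in>I. H_sober H (X i)"
    show "H_sober H P"
      unfolding H_sober_def
    proof (intro conjI ballI t0P)
      fix A assume A: "A \<in> H P"
      have irr: "irreducible_in P A" using R_subset_systemD(1)[OF H t0P A] .
      then have AP: "A \<subseteq> topspace P" by (rule irreducible_in_subset_topspace)
      have irrQ: "irreducible_in ?Q (h ` A)"
        using irreducible_in_continuous_map_image[OF h irr] .
      have "\<exists>x\<in>topspace (X i). X i closure_of ((\<lambda>b. b i) ` h ` A) = X i closure_of {x}"
        if i: "i \<in> I" for i
      proof -
        have "continuous_map P (X i) ((\<lambda>b. b i) \<circ> h)"
          using continuous_map_compose[OF h continuous_map_product_projection[OF i]] .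
        from R_subset_systemD(2)[OF H t0P assms(2)[OF i] this A]
        have "(\<lambda>b. b i) ` h ` A \<in> H (X i)" by (simp add: image_comp)
        with fac i show ?thesis unfolding H_sober_def by blast
      qed
      then obtain x0 where x0: "\<And>i. i \<in> I \<Longrightarrow> x0 i \<in> topspace (X i)"
        "\<And>i. i \<in> I \<Longrightarrow> X i closure_of ((\<lambda>b. b i) ` h ` A) = X i closure_of {x0 i}"
        by metis
      define x where "x = restrict x0 I"
      have x: "x \<in> topspace ?Q" using x0(1) by (auto simp: x_def)
      have "?Q closure_of (h ` A) = ?Q closure_of {x}"
        by (rule generic_point_in_product[OF irrQ x]) (simp add: x_def x0(2))
      from continuous_map_closure_of_eq_image[OF g irreducible_in_subset_topspace[OF irrQ] x this]
      have "P closure_of (g ` h ` A) = P closure_of {g x}" .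
      moreover have "g ` h ` A = A" using AP gh by force
      moreover have "g x \<in> topspace P" using continuous_map_funspace[OF g] x by auto
      ultimately show "\<exists>x\<in>topspace P. P closure_of A = P closure_of {x}" by auto
    qed
  qed
qed

end
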